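(* Let $S\equiv(S,I,\mathbf d,\mathbf r,\cdot)$ be a stable partial semigroup, let $i,j\in I$, and let $a\in S_{ji}$ be regular. Fix some $b\in V(a)$. Let $J_b^a$ and $D_b^a$ denote the $\mathscr J^a$- and $\mathscr D^a$-classes of $b$ in $S_{ij}^a$. Then (i) $J_b^a=D_b^a$; (ii) $E(J_b^a)=V(a)$ is a rectangular band (under $\star_a$); (iii) $J_b^a$ is a rectangular group (under $\star_a$); (iv) if $S$ is regular, then $J_b^a=\operatorname{RP}(P^a)$ and $E(J_b^a)=\operatorname{MI}(P^a)$, where $P^a=\operatorname{Reg}(S_{ij}^a)$.
   Context: A partial semigroup $(S,I,\mathbf d,\mathbf r,\cdot)$ consists of sets $S,I$, maps $\mathbf d,\mathbf r:S\to I$ and a partial binary operation on $S$ such that: $x\cdot y$ is defined iff $\mathbf r(x)=\mathbf d(y)$, in which case $\mathbf d(xy)=\mathbf d(x)$ and $\mathbf r(xy)=\mathbf r(y)$; and $(xy)z=x(yz)$ whenever $xy$ and $yz$ are defined. $S_{ij}=\{x\in S:\mathbf d(x)=i,\ \mathbf r(x)=j\}$. An element $a\in S$ is regular if $a=axa$ for some $x\in S$; $S$ is regular if all its elements are. $V(a)=\{x\in S:a=axa,\ x=xax\}$. $S^{(1)}$ denotes the category obtained from $S$ by adjoining an identity at each object that does not already have one. On $S$: $x\leq_{\mathscr R}y$ iff $x\in yS^{(1)}$, $x\leq_{\mathscr L}y$ iff $x\in S^{(1)}y$, $x\leq_{\mathscr J}y$ iff $x\in S^{(1)}yS^{(1)}$,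 and $\mathscr K={\leq_{\mathscr K}}\cap{\geq_{\mathscr K}}$ for $\mathscr K\in\{\mathscr R,\mathscr L,\mathscr J\}$. $S$ is stable if for all $x,u\in S$: $x\,\mathscr J\,xu\Rightarrow x\,\mathscr R\,xu$, and $x\,\mathscr J\,ux\Rightarrow x\,\mathscr L\,ux$ (whenever the products are defined). For $a\in S_{ji}$, the sandwich semigroup $S_{ij}^a$ is the set $S_{ij}$ with the associative operation $x\star_ay=xay$; $\mathscr J^a$, $\mathscr D^a$ are Green's $\mathscr J$ and $\mathscr D$ relations of $S_{ij}^a$. $E(A)$ denotes the set of $\star_a$-idempotents contained in $A\subseteq S_{ij}$. $\operatorname{Reg}(T)$ is the set of regular elements of a semigroup $T$ (when $S$ is regular, $P^a=\operatorname{Reg}(S_{ij}^a)$ is a regular subsemigroup of $S_{ij}^a$). A rectangular band is a semigroup isomorphic to a direct product of a left-zero semigroup ($uv=u$) and a right-zero semigroup ($uv=v$); a rectangular group is a semigroup isomorphic to a direct product of a rectangular band and a group. For a regular semigroup $T$: $u\in T$ is a mid-identity if $xy=xuy$ for all $x,y\in T$; $u\in T$ is regularity-preserving if the semigroup $T$ with operation $x\star_uy=xuy$ is regular; $\operatorname{MI}(T)$ and $\operatorname{RP}(T)$ are the sets of all mid-identities and all regularity-preserving elements of $T$. *)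

theory Defs
  imports "HOL-Algebra.Group"
begin

section \<open>Partial semigroups\<close>

text \<open>
  The partial operation is encoded by a total function whose values matter only on composable
  pairs, that is, when \<open>tgt S x = src S y\<close>; all definitions below guard their products accordingly.
  Composition is written in diagrammatic order.
\<close>

record ('s, 'i) psgp = "'s partial_object" +
  objs :: "'i set"
  src  :: "'s \<Rightarrow> 'i"
  tgt  :: "'s \<Rightarrow> 'i"
  comp :: "'s \<Rightarrow> 's \<Rightarrow> 's"  (infixl "\<odot>\<index>" 70)

locale partial_semigroup =
  fixes S :: "('s, 'i) psgp" (structure)
  assumes src_in: "x \<in> carrier S \<Longrightarrow> src S x \<in> objs S"
    and tgt_in: "x \<in> carrier S \<Longrightarrow> tgt S x \<in> objs S"
    and comp_closed:
      "\<lbrakk>x \<in> carrier S; y \<in> carrier S; tgt S x = src S y\<rbrakk> \<Longrightarrow> x \<odot> y \<in> carrier S"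
    and src_comp:
      "\<lbrakk>x \<in> carrier S; y \<in> carrier S; tgt S x = src S y\<rbrakk> \<Longrightarrow> src S (x \<odot> y) = src S x"
    and tgt_comp:
      "\<lbrakk>x \<in> carrier S; y \<in> carrier S; tgt S x = src S y\<rbrakk> \<Longrightarrow> tgt S (x \<odot> y) = tgt S y"
    and comp_assoc:
      "\<lbrakk>x \<in> carrier S; y \<in> carrier S; z \<in> carrier S; tgt S x = src S y; tgt S y = src S z\<rbrakk>
        \<Longrightarrow> (x \<odot> y) \<odot> z = x \<odot> (y \<odot> z)"

definition hom_set :: "('s, 'i) psgp \<Rightarrow> 'i \<Rightarrow> 'i \<Rightarrow> 's set"
  where "hom_set S i j = {x \<in> carrier S. src S x = i \<and> tgt S x = j}"

definition regular_elem :: "('s, 'i) psgp \<Rightarrow> 's \<Rightarrow> bool"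
  where "regular_elem S a \<longleftrightarrow> a \<in> carrier S \<and>
    (\<exists>x \<in> carrier S. tgt S a = src S x \<and> tgt S x = src S a \<and> a = a \<odot>\<^bsub>S\<^esub> x \<odot>\<^bsub>S\<^esub> a)"

definition Reg :: "('s, 'i) psgp \<Rightarrow> 's set"
  where "Reg S = {x. regular_elem S x}"

definition regular_psgp :: "('s, 'i) psgp \<Rightarrow> bool"
  where "regular_psgp S \<longleftrightarrow> (\<forall>x \<in> carrier S. regular_elem S x)"

definition inverses :: "('s, 'i) psgp \<Rightarrow> 's \<Rightarrow> 's set"
  where "inverses S a = {x \<in> carrier S. tgt S a = src S x \<and> tgt S x = src S a \<and>
    a = a \<odot>\<^bsub>S\<^esub> x \<odot>\<^bsub>S\<^esub> a \<and> x = x \<odot>\<^bsub>S\<^esub> a \<odot>\<^bsub>S\<^esub> x}"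


section \<open>Green's relations\<close>

definition identity_at :: "('s, 'i) psgp \<Rightarrow> 'i \<Rightarrow> 's \<Rightarrow> bool"
  where "identity_at S i e \<longleftrightarrow> e \<in> hom_set S i i \<and>
    (\<forall>x \<in> carrier S. src S x = i \<longrightarrow> e \<odot>\<^bsub>S\<^esub> x = x) \<and>
    (\<forall>x \<in> carrier S. tgt S x = i \<longrightarrow> x \<odot>\<^bsub>S\<^esub> e = x)"

text \<open>
  The category \<open>S\<^sup>(\<^sup>1\<^sup>)\<close>: \<open>Inl x\<close> is the original element \<open>x\<close>, and \<open>Inr i\<close> is the identity adjoined
  at an object \<open>i\<close> that has none in \<open>S\<close>.
\<close>

definition adjoin_ids :: "('s, 'i) psgp \<Rightarrow> ('s + 'i, 'i) psgp"
  where "adjoin_ids S =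
    \<lparr>carrier = Inl ` carrier S \<union> Inr ` {i \<in> objs S. \<nexists>e. identity_at S i e},
     objs = objs S,
     src = case_sum (src S) id,
     tgt = case_sum (tgt S) id,
     comp = (\<lambda>u v. case u of
         Inr _ \<Rightarrow> v
       | Inl x \<Rightarrow> (case v of Inr _ \<Rightarrow> u | Inl y \<Rightarrow> Inl (x \<odot>\<^bsub>S\<^esub> y)))\<rparr>"

definition le_R :: "('s, 'i) psgp \<Rightarrow> 's rel"
  where "le_R S = {(x, y). x \<in> carrier S \<and> y \<in> carrier S \<and>
    (\<exists>u \<in> carrier (adjoin_ids S). tgt S y = src (adjoin_ids S) u \<and>
       Inl x = Inl y \<odot>\<^bsub>adjoin_ids S\<^esub> u)}"

definition le_L :: "('s, 'i) psgp \<Rightarrow> 's rel"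
  where "le_L S = {(x, y). x \<in> carrier S \<and> y \<in> carrier S \<and>
    (\<exists>u \<in> carrier (adjoin_ids S). tgt (adjoin_ids S) u = src S y \<and>
       Inl x = u \<odot>\<^bsub>adjoin_ids S\<^esub> Inl y)}"

definition le_J :: "('s, 'i) psgp \<Rightarrow> 's rel"
  where "le_J S = {(x, y). x \<in> carrier S \<and> y \<in> carrier S \<and>
    (\<exists>u \<in> carrier (adjoin_ids S). \<exists>v \<in> carrier (adjoin_ids S).
       tgt (adjoin_ids S) u = src S y \<and> tgt S y = src (adjoin_ids S) v \<and>
       Inl x = u \<odot>\<^bsub>adjoin_ids S\<^esub> Inl y \<odot>\<^bsub>adjoin_ids S\<^esub> v)}"

definition green_R :: "('s, 'i) psgp \<Rightarrow> 's rel"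
  where "green_R S = le_R S \<inter> (le_R S)\<inverse>"

definition green_L :: "('s, 'i) psgp \<Rightarrow> 's rel"
  where "green_L S = le_L S \<inter> (le_L S)\<inverse>"

definition green_J :: "('s, 'i) psgp \<Rightarrow> 's rel"
  where "green_J S = le_J S \<inter> (le_J S)\<inverse>"

text \<open>The join of the equivalence relations \<open>\<R>\<close> and \<open>\<L>\<close>.\<close>

definition green_D :: "('s, 'i) psgp \<Rightarrow> 's rel"
  where "green_D S = (green_R S \<union> green_L S)\<^sup>+"

definition stable :: "('s, 'i) psgp \<Rightarrow> bool"
  where "stable S \<longleftrightarrow> (\<forall>x \<in> carrier S. \<forall>u \<in> carrier S.
    (tgt S x = src S u \<longrightarrow> (x, x \<odot>\<^bsub>S\<^esub> u) \<in> green_J S \<longrightarrow> (x, x \<odot>\<^bsub>S\<^esub> u) \<in> green_R S) \<and>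
    (tgt S u = src S x \<longrightarrow> (x, u \<odot>\<^bsub>S\<^esub> x) \<in> green_J S \<longrightarrow> (x, u \<odot>\<^bsub>S\<^esub> x) \<in> green_L S))"


section \<open>Semigroups\<close>

text \<open>
  A semigroup is a partial semigroup with the single object \<open>()\<close>. Everything above then specialises
  to the usual notions; in particular \<open>adjoin_ids T\<close> is the monoid \<open>T\<^sup>1\<close>.
\<close>

type_synonym 's sgp = "('s, unit) psgp"

abbreviation semigrp :: "'s sgp \<Rightarrow> bool"
  where "semigrp T \<equiv> partial_semigroup T \<and> objs T = {()}"

definition sandwich :: "('s, 'i) psgp \<Rightarrow> 'i \<Rightarrow> 'i \<Rightarrow> 's \<Rightarrow> 's sgp"
  where "sandwich S i j a =
    \<lparr>carrier = hom_set S i j, objs = {()}, src = (\<lambda>_. ()), tgt = (\<lambda>_. ()),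
     comp = (\<lambda>x y. x \<odot>\<^bsub>S\<^esub> a \<odot>\<^bsub>S\<^esub> y)\<rparr>"

definition restrict_to :: "'s sgp \<Rightarrow> 's set \<Rightarrow> 's sgp"
  where "restrict_to T A = T\<lparr>carrier := A\<rparr>"

definition idempotents :: "'s sgp \<Rightarrow> 's set \<Rightarrow> 's set"
  where "idempotents T A = {x \<in> A. x \<odot>\<^bsub>T\<^esub> x = x}"

definition sgp_prod :: "'s sgp \<Rightarrow> 't sgp \<Rightarrow> ('s \<times> 't) sgp"
  where "sgp_prod T U =
    \<lparr>carrier = carrier T \<times> carrier U, objs = {()}, src = (\<lambda>_. ()), tgt = (\<lambda>_. ()),
     comp = (\<lambda>(x, y) (x', y'). (x \<odot>\<^bsub>T\<^esub> x', y \<odot>\<^bsub>U\<^esub> y'))\<rparr>"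

definition sgp_isomorphic :: "'s sgp \<Rightarrow> 't sgp \<Rightarrow> bool"
  where "sgp_isomorphic T U \<longleftrightarrow> semigrp T \<and> semigrp U \<and>
    (\<exists>f. bij_betw f (carrier T) (carrier U) \<and>
      (\<forall>x \<in> carrier T. \<forall>y \<in> carrier T. f (x \<odot>\<^bsub>T\<^esub> y) = f x \<odot>\<^bsub>U\<^esub> f y))"

definition left_zero_semigrp :: "'s sgp \<Rightarrow> bool"
  where "left_zero_semigrp T \<longleftrightarrow> semigrp T \<and>
    (\<forall>u \<in> carrier T. \<forall>v \<in> carrier T. u \<odot>\<^bsub>T\<^esub> v = u)"

definition right_zero_semigrp :: "'s sgp \<Rightarrow> bool"
  where "right_zero_semigrp T \<longleftrightarrow> semigrp T \<and>
    (\<forall>u \<in> carrier T. \<forall>v \<in> carrier T. u \<odot>\<^bsub>T\<^esub> v = v)"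

definition group_semigrp :: "'s sgp \<Rightarrow> bool"
  where "group_semigrp T \<longleftrightarrow> semigrp T \<and>
    (\<exists>e. group \<lparr>carrier = carrier T, monoid.mult = comp T, one = e\<rparr>)"

text \<open>
  In the next two definitions the factors range over structures on the type of \<open>T\<close> itself. This is
  no restriction: if \<open>T\<close> is nonempty then so are the factors, hence each has a bijection with a
  subset of \<open>T\<close> along which its operation can be transported; if \<open>T\<close> is empty, empty factors do.
\<close>

definition rectangular_band :: "'s sgp \<Rightarrow> bool"
  where "rectangular_band T \<longleftrightarrow> (\<exists>(L :: 's sgp) (R :: 's sgp).
    left_zero_semigrp L \<and> right_zero_semigrp R \<and> sgp_isomorphic T (sgp_prod L R))"

definition rectangular_group :: "'s sgp \<Rightarrow> bool"
  where "rectangular_group T \<longleftrightarrow> (\<exists>(B :: 's sgp) (G :: 's sgp).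
    rectangular_band B \<and> group_semigrp G \<and> sgp_isomorphic T (sgp_prod B G))"

definition MI :: "'s sgp \<Rightarrow> 's set"
  where "MI T = {u \<in> carrier T. \<forall>x \<in> carrier T. \<forall>y \<in> carrier T.
    x \<odot>\<^bsub>T\<^esub> y = x \<odot>\<^bsub>T\<^esub> u \<odot>\<^bsub>T\<^esub> y}"

text \<open>\<open>sandwich T () () u\<close> is the semigroup on all of \<open>T\<close> with operation \<open>x \<star>\<^sub>u y = xuy\<close>.\<close>

definition RP :: "'s sgp \<Rightarrow> 's set"
  where "RP T = {u \<in> carrier T. regular_psgp (sandwich T () () u)}"

end

theory Submission
  imports Defs
begin

text \<open>
  Write \<open>x \<star> y = x a y\<close> for the operation of \<open>T = S\<^sub>i\<^sub>j\<^sup>a\<close>. Since \<open>a b a = a\<close> and \<open>b a b = b\<close>, the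
  element \<open>b\<close> is an idempotent mid-identity of \<open>T\<close>, so \<open>x \<mapsto> b \<star> x \<star> b\<close> is a homomorphism from \<open>T\<close> onto
  the monoid \<open>b \<star> T \<star> b\<close>, whose identity is \<open>b\<close>. Stability of \<open>S\<close> enters once
  (\<open>sandwich_stable_mid_identity\<close>): if \<open>b = u \<star> x \<star> v\<close>, then \<open>a\<close> is \<open>\<J>\<close>-related in \<open>S\<close> to \<open>a x a\<close>, hence
  both \<open>\<R>\<close>- and \<open>\<L>\<close>-related to it, and so \<open>b \<star> x \<star> b\<close> is a unit of \<open>b \<star> T \<star> b\<close>. The rest is an
  argument about semigroups with an idempotent mid-identity having this property.

  The \<open>\<J>\<close>-class of \<open>b\<close> consists of the products \<open>x = p \<star> q\<close> whose image \<open>b \<star> x \<star> b\<close> is a unit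
  (\<open>green_J_b\<close>). The images of both factors are then units as well, which gives
  \<open>b \<R> b \<star> q \<L> p \<star> q\<close> and thus \<open>\<D> = \<J>\<close> on this class (\<open>green_D_b\<close>). It also gives \<open>x \<star> h \<star> x = x\<close> for
  every \<open>h\<close> whose image is inverse to that of \<open>x\<close> (\<open>block_inner_inverse\<close>), so the class is exactly
  the set of regular elements of \<open>T\<close> with invertible image (\<open>block_eq_regular\<close>).

  The idempotents of the class are the idempotents of \<open>T\<close> with image \<open>b\<close>, and these are the inverses
  of \<open>a\<close>. They are themselves mid-identities, so \<open>x \<mapsto> (x \<star> b, b \<star> x)\<close> exhibits them as a rectangular
  band \<open>E\<close>. With \<open>h\<close> as above, \<open>x \<mapsto> (x \<star> h \<star> h \<star> x, b \<star> x \<star> b)\<close> is an isomorphism from the class onto the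
  product of \<open>E\<close> and the group of units, with inverse \<open>(e, g) \<mapsto> e \<star> g \<star> e\<close>.

  If \<open>S\<close> is regular, then \<open>P = Reg T\<close> is a subsemigroup. A mid-identity \<open>u\<close> of \<open>P\<close> satisfies
  \<open>b \<star> u \<star> b = b \<star> b = b\<close>, and regularity makes it idempotent. If \<open>u\<close> preserves regularity, then regularity of
  \<open>b\<close> under \<open>x \<star> u \<star> y\<close> puts \<open>u\<close> above \<open>b\<close>, so its image is a unit; conversely, a unit image can be
  cancelled in the middle of any product, which turns an inverse of \<open>x\<close> in \<open>P\<close> into one for the operation
  \<open>x \<star> u \<star> y\<close>.
\<close>

section \<open>Green's preorders without adjoined identities\<close>

context partial_semigroup
begin

lemma adjoined_identity:
  assumes "i \<in> objs S"
  obtains u where "u \<in> carrier (adjoin_ids S)" "src (adjoin_ids S) u = i" "tgt (adjoin_ids S) u = i"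
    "\<And>x. x \<in> carrier S \<Longrightarrow> tgt S x = i \<Longrightarrow> Inl x \<odot>\<^bsub>adjoin_ids S\<^esub> u = Inl x"
    "\<And>x. x \<in> carrier S \<Longrightarrow> src S x = i \<Longrightarrow> u \<odot>\<^bsub>adjoin_ids S\<^esub> Inl x = Inl x"
proof (cases "\<exists>e. identity_at S i e")
  case True
  then obtain e where "identity_at S i e" by blast
  then show ?thesis
    by (intro that[of "Inl e"]) (auto simp: adjoin_ids_def identity_at_def hom_set_def)
next
  case False
  then show ?thesis
    using assms by (intro that[of "Inr i"]) (auto simp: adjoin_ids_def)
qed

lemma le_R_iff:
  "(x, y) \<in> le_R S \<longleftrightarrow> x \<in> carrier S \<and> y \<in> carrier S \<and>
    (x = y \<or> (\<exists>u \<in> carrier S. tgt S y = src S u \<and> x = y \<odot> u))" (is "?l \<longleftrightarrow> ?r")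
proof
  assume ?l
  then show ?r by (auto simp: le_R_def adjoin_ids_def)
next
  assume r: ?r
  then have c: "x \<in> carrier S" "y \<in> carrier S" by auto
  from r consider "x = y" | u where "u \<in> carrier S" "tgt S y = src S u" "x = y \<odot> u" by blast
  then show ?l
  proof cases
    case 1
    obtain u where "u \<in> carrier (adjoin_ids S)" "src (adjoin_ids S) u = tgt S y"
      "Inl y \<odot>\<^bsub>adjoin_ids S\<^esub> u = Inl y"
      using adjoined_identity[OF tgt_in[OF c(2)]] c(2) by metis
    then show ?thesis using 1 c unfolding le_R_def by force
  next
    case 2
    then show ?thesis using c unfolding le_R_def
      by (auto simp: adjoin_ids_def intro!: bexI[of _ "Inl u"])
  qed
qed

lemma le_L_iff:
  "(x, y) \<in> le_L S \<longleftrightarrow> x \<in> carrier S \<and> y \<in> carrier S \<and>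
    (x = y \<or> (\<exists>u \<in> carrier S. tgt S u = src S y \<and> x = u \<odot> y))" (is "?l \<longleftrightarrow> ?r")
proof
  assume ?l
  then show ?r by (auto simp: le_L_def adjoin_ids_def)
next
  assume r: ?r
  then have c: "x \<in> carrier S" "y \<in> carrier S" by auto
  from r consider "x = y" | u where "u \<in> carrier S" "tgt S u = src S y" "x = u \<odot> y" by blast
  then show ?l
  proof cases
    case 1
    obtain u where "u \<in> carrier (adjoin_ids S)" "tgt (adjoin_ids S) u = src S y"
      "u \<odot>\<^bsub>adjoin_ids S\<^esub> Inl y = Inl y"
      using adjoined_identity[OF src_in[OF c(2)]] c(2) by metis
    then show ?thesis using 1 c unfolding le_L_def by force
  next
    case 2
    then show ?thesis using c unfolding le_L_def
      by (auto simp: adjoin_ids_def intro!: bexI[of _ "Inl u"])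
  qed
qed

lemma le_J_cases:
  assumes "(x, y) \<in> le_J S"
  obtains "x = y"
    | u where "u \<in> carrier S" "tgt S u = src S y" "x = u \<odot> y"
    | v where "v \<in> carrier S" "tgt S y = src S v" "x = y \<odot> v"
    | u v where "u \<in> carrier S" "v \<in> carrier S" "tgt S u = src S y" "tgt S y = src S v"
        "x = u \<odot> y \<odot> v"
  using assms by (auto simp: le_J_def adjoin_ids_def)

lemma le_J_comp:
  assumes "u \<in> carrier S" "y \<in> carrier S" "v \<in> carrier S" "tgt S u = src S y" "tgt S y = src S v"
  shows "(u \<odot> y \<odot> v, y) \<in> le_J S"
proof -
  have "Inl u \<in> carrier (adjoin_ids S)" "Inl v \<in> carrier (adjoin_ids S)"
    "tgt (adjoin_ids S) (Inl u) = src S y" "src (adjoin_ids S) (Inl v) = tgt S y"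
    "Inl (u \<odot> y \<odot> v) = Inl u \<odot>\<^bsub>adjoin_ids S\<^esub> Inl y \<odot>\<^bsub>adjoin_ids S\<^esub> Inl v"
    using assms by (simp_all add: adjoin_ids_def)
  moreover have "u \<odot> y \<odot> v \<in> carrier S" using assms by (simp add: comp_closed tgt_comp)
  ultimately show ?thesis
    using assms unfolding le_J_def by (simp, metis)
qed

lemma le_R_imp_le_J:
  assumes "(x, y) \<in> le_R S"
  shows "(x, y) \<in> le_J S"
proof -
  have c: "x \<in> carrier S" "y \<in> carrier S" using assms by (auto simp: le_R_def)
  obtain u where u: "u \<in> carrier (adjoin_ids S)" "tgt (adjoin_ids S) u = src S y"
    "u \<odot>\<^bsub>adjoin_ids S\<^esub> Inl y = Inl y"
    using adjoined_identity[OF src_in[OF c(2)]] c(2) by metis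
  obtain v where v: "v \<in> carrier (adjoin_ids S)" "tgt S y = src (adjoin_ids S) v"
    "Inl x = Inl y \<odot>\<^bsub>adjoin_ids S\<^esub> v"
    using assms by (auto simp: le_R_def)
  show ?thesis
    using c u v unfolding le_J_def by (simp, metis)
qed

lemma le_L_imp_le_J:
  assumes "(x, y) \<in> le_L S"
  shows "(x, y) \<in> le_J S"
proof -
  have c: "x \<in> carrier S" "y \<in> carrier S" using assms by (auto simp: le_L_def)
  obtain u where u: "u \<in> carrier (adjoin_ids S)" "tgt (adjoin_ids S) u = src S y"
    "Inl x = u \<odot>\<^bsub>adjoin_ids S\<^esub> Inl y"
    using assms by (auto simp: le_L_def)
  obtain v where v: "v \<in> carrier (adjoin_ids S)" "src (adjoin_ids S) v = tgt S y"
    "tgt S x = tgt S y \<Longrightarrow> Inl x \<odot>\<^bsub>adjoin_ids S\<^esub> v = Inl x"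
    using adjoined_identity[OF tgt_in[OF c(2)]] c(1) by metis
  have "tgt S x = tgt S y"
    using assms by (auto simp: le_L_iff tgt_comp)
  with c u v show ?thesis
    unfolding le_J_def by (simp, metis)
qed

end


section \<open>Semigroups with a mid-identity\<close>

text \<open>A semigroup: all composability conditions are trivial.\<close>

locale one_object = partial_semigroup T for T :: "'s sgp" (structure) +
  assumes objs_unit: "objs T = {()}"
begin

lemma closed [simp, intro]: "x \<in> carrier T \<Longrightarrow> y \<in> carrier T \<Longrightarrow> x \<odot> y \<in> carrier T"
  by (simp add: comp_closed)

lemma assoc [simp]:
  "x \<in> carrier T \<Longrightarrow> y \<in> carrier T \<Longrightarrow> z \<in> carrier T \<Longrightarrow> x \<odot> y \<odot> z = x \<odot> (y \<odot> z)"
  by (simp add: comp_assoc)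

lemma restrict_semigrp:
  assumes "A \<subseteq> carrier T" "\<And>x y. x \<in> A \<Longrightarrow> y \<in> A \<Longrightarrow> x \<odot> y \<in> A"
  shows "semigrp (restrict_to T A)"
  using assms objs_unit by (auto simp: restrict_to_def partial_semigroup_def subset_iff)

lemma le_R_iff_one:
  "(x, y) \<in> le_R T \<longleftrightarrow> x \<in> carrier T \<and> y \<in> carrier T \<and> (x = y \<or> (\<exists>u \<in> carrier T. x = y \<odot> u))"
  by (simp add: le_R_iff)

lemma le_L_iff_one:
  "(x, y) \<in> le_L T \<longleftrightarrow> x \<in> carrier T \<and> y \<in> carrier T \<and> (x = y \<or> (\<exists>u \<in> carrier T. x = u \<odot> y))"
  by (simp add: le_L_iff)

lemma regular_elem_iff:
  "regular_elem T x \<longleftrightarrow> x \<in> carrier T \<and> (\<exists>y \<in> carrier T. x = x \<odot> (y \<odot> x))"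
  unfolding regular_elem_def by auto

end

lemma sgp_prod_semigrp:
  assumes "semigrp T" "semigrp U"
  shows "semigrp (sgp_prod T U)"
  using assms by (auto simp: sgp_prod_def partial_semigroup_def)

text \<open>A semigroup with a distinguished idempotent mid-identity \<open>b\<close>. The products \<open>b x b\<close> form a
  monoid with identity \<open>b\<close>, and \<open>x \<mapsto> b x b\<close> is a homomorphism onto it.\<close>

locale mid_identity = one_object +
  fixes b :: 'a
  assumes b_in [simp]: "b \<in> carrier T"
    and b_idem [simp]: "b \<odot> b = b"
    and mid_left: "x \<in> carrier T \<Longrightarrow> y \<in> carrier T \<Longrightarrow> x \<odot> b \<odot> y = x \<odot> y"
begin

lemma mid [simp]: "x \<in> carrier T \<Longrightarrow> y \<in> carrier T \<Longrightarrow> x \<odot> (b \<odot> y) = x \<odot> y"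
  using mid_left by simp

text \<open>An \<open>inverse_pair\<close> consists of elements whose images \<open>b x b\<close> and \<open>b h b\<close> are mutually
  inverse in the monoid \<open>b T b\<close>. The elements themselves need not lie in \<open>b T b\<close>, so an \<open>h\<close> paired
  with \<open>x\<close> need not be unique.\<close>

definition inverse_pair :: "'a \<Rightarrow> 'a \<Rightarrow> bool"
  where "inverse_pair x h \<longleftrightarrow> x \<in> carrier T \<and> h \<in> carrier T \<and>
    b \<odot> (x \<odot> (h \<odot> b)) = b \<and> b \<odot> (h \<odot> (x \<odot> b)) = b"

lemma inverse_pair_carrier:
  "inverse_pair x h \<Longrightarrow> x \<in> carrier T" "inverse_pair x h \<Longrightarrow> h \<in> carrier T"
  by (auto simp: inverse_pair_def)

lemma inverse_pair_sym: "inverse_pair x h \<Longrightarrow> inverse_pair h x"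
  by (auto simp: inverse_pair_def)

text \<open>Between two further factors, the two members of an inverse pair cancel without any \<open>b\<close> being
  written. Most computations below rest on this rule.\<close>

lemma cancel:
  assumes "inverse_pair x h" "y \<in> carrier T" "z \<in> carrier T"
  shows "y \<odot> (x \<odot> (h \<odot> z)) = y \<odot> z"
proof -
  have c: "x \<in> carrier T" "h \<in> carrier T" and e: "b \<odot> (x \<odot> (h \<odot> b)) = b"
    using assms(1) by (auto simp: inverse_pair_def)
  have "y \<odot> (x \<odot> (h \<odot> z)) = y \<odot> (b \<odot> (x \<odot> (h \<odot> b)) \<odot> z)"
    using c assms by simp
  then show ?thesis using e assms by simp
qed

lemma inverse_pair_b: "inverse_pair b b"
  by (simp add: inverse_pair_def)

lemma inverse_pair_mult:
  assumes "inverse_pair x h" "inverse_pair y k"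
  shows "inverse_pair (x \<odot> y) (k \<odot> h)"
  using assms inverse_pair_carrier[OF assms(1)] inverse_pair_carrier[OF assms(2)]
  by (simp add: inverse_pair_def[of "x \<odot> y"] cancel inverse_pair_sym)

lemma inverse_pair_localise:
  assumes "inverse_pair x h"
  shows "inverse_pair (b \<odot> (x \<odot> b)) (b \<odot> (h \<odot> b))"
proof -
  note c = inverse_pair_carrier[OF assms]
  have "b \<odot> (b \<odot> (x \<odot> b) \<odot> (b \<odot> (h \<odot> b) \<odot> b)) = b \<odot> (x \<odot> (h \<odot> b))"
    "b \<odot> (b \<odot> (h \<odot> b) \<odot> (b \<odot> (x \<odot> b) \<odot> b)) = b \<odot> (h \<odot> (x \<odot> b))"
    using c by simp_all
  moreover have "b \<odot> (x \<odot> (h \<odot> b)) = b" "b \<odot> (h \<odot> (x \<odot> b)) = b"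
    using assms by (simp_all only: inverse_pair_def)
  ultimately show ?thesis
    unfolding inverse_pair_def[of "b \<odot> (x \<odot> b)"] using c by (simp only: closed b_in)
qed

text \<open>The idempotents with image \<open>b\<close>.\<close>

definition idem_part :: "'a set"
  where "idem_part = {x \<in> carrier T. x \<odot> x = x \<and> b \<odot> (x \<odot> b) = b}"

text \<open>The group of units of the monoid \<open>b T b\<close>.\<close>

definition unit_part :: "'a set"
  where "unit_part = {x \<in> carrier T. b \<odot> (x \<odot> b) = x \<and> (\<exists>h. inverse_pair x h)}"

text \<open>The elements of \<open>T T = T b T\<close> with invertible image. Under the assumption of the next section this
  is the \<open>\<J>\<close>-class of \<open>b\<close>.\<close>

definition block :: "'a set"
  where "block = {x \<in> carrier T. (\<exists>p \<in> carrier T. \<exists>q \<in> carrier T. x = p \<odot> q) \<and>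
    (\<exists>h. inverse_pair x h)}"

lemma idem_part_pair: "x \<in> idem_part \<Longrightarrow> inverse_pair x b"
  by (auto simp: idem_part_def inverse_pair_def)

lemma idem_part_mid:
  assumes "x \<in> idem_part" "y \<in> carrier T" "z \<in> carrier T"
  shows "y \<odot> (x \<odot> z) = y \<odot> z"
  using cancel[OF idem_part_pair[OF assms(1)] assms(2,3)] assms
  by (simp add: idem_part_def)

lemma idem_part_mult:
  assumes "x \<in> idem_part" "y \<in> idem_part"
  shows "x \<odot> y \<in> idem_part"
  using assms by (auto simp: idem_part_def idem_part_mid[OF assms(1)] idem_part_mid[OF assms(2)])

lemma idempotents_block: "idempotents T block = idem_part"
proof (intro Set.set_eqI iffI)
  fix x assume "x \<in> idempotents T block"
  then obtain h where x: "x \<in> carrier T" "x \<odot> x = x" and h: "inverse_pair x h"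
    by (auto simp: idempotents_def block_def)
  note hc = inverse_pair_carrier(2)[OF h]
  have "b \<odot> (x \<odot> b) = b \<odot> (x \<odot> (x \<odot> (h \<odot> b)))"
    using cancel[OF h, of "b \<odot> x" b] x hc by simp
  also have "\<dots> = b \<odot> ((x \<odot> x) \<odot> (h \<odot> b))" using x(1) hc by simp
  also have "\<dots> = b" using h x(2) by (simp add: inverse_pair_def)
  finally show "x \<in> idem_part" using x by (simp add: idem_part_def)
next
  fix x assume x: "x \<in> idem_part"
  then have "x \<in> carrier T" "x = x \<odot> x" by (auto simp: idem_part_def)
  with idem_part_pair[OF x] show "x \<in> idempotents T block"
    unfolding idempotents_def block_def by auto
qed

text \<open>The factors are the left-zero semigroup \<open>E b\<close> and the right-zero semigroup \<open>b E\<close>, where \<open>E\<close> is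
  the set of idempotents with image \<open>b\<close>.\<close>

theorem rectangular_band_idem_part: "rectangular_band (restrict_to T idem_part)"
proof -
  define L where "L = (\<lambda>x. x \<odot> b) ` idem_part"
  define R where "R = (\<lambda>x. b \<odot> x) ` idem_part"
  define f where "f x = (x \<odot> b, b \<odot> x)" for x
  note E_def = idem_part_def
  have Ec: "\<And>x. x \<in> idem_part \<Longrightarrow> x \<in> carrier T" by (simp add: E_def)
  have bE: "b \<in> idem_part" by (simp add: E_def)
  have Lz: "u \<odot> v = u" if "u \<in> L" "v \<in> L" for u v
    using that by (auto simp: L_def Ec idem_part_mid)
  have Rz: "u \<odot> v = v" if "u \<in> R" "v \<in> R" for u v
    using that by (auto simp: R_def Ec idem_part_mid)
  have sL: "semigrp (restrict_to T L)"
    by (rule restrict_semigrp) (simp_all add: Lz, auto simp: L_def Ec)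
  have sR: "semigrp (restrict_to T R)"
    by (rule restrict_semigrp) (simp_all add: Rz, auto simp: R_def Ec)
  have sE: "semigrp (restrict_to T idem_part)"
    by (rule restrict_semigrp) (auto simp: Ec idem_part_mult)
  have mult: "f (x \<odot> y) = (x \<odot> b, b \<odot> y)" if "x \<in> idem_part" "y \<in> idem_part" for x y
    using that by (simp add: f_def Ec idem_part_mid)
  have "bij_betw f idem_part (L \<times> R)"
  proof (rule bij_betwI[where g = "\<lambda>(l, r). l \<odot> r"])
    show "f \<in> idem_part \<rightarrow> L \<times> R" by (auto simp: f_def L_def R_def)
    show "(\<lambda>(l, r). l \<odot> r) \<in> L \<times> R \<rightarrow> idem_part"
      by (auto simp: L_def R_def Ec idem_part_mult)
    show "(\<lambda>(l, r). l \<odot> r) (f x) = x" if "x \<in> idem_part" for x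
      using that by (auto simp: f_def E_def)
    show "f ((\<lambda>(l, r). l \<odot> r) y) = y" if "y \<in> L \<times> R" for y
      using that by (auto simp: L_def R_def Ec mult)
  qed
  moreover have "f (x \<odot> y) = (fst (f x) \<odot> fst (f y), snd (f x) \<odot> snd (f y))"
    if "x \<in> idem_part" "y \<in> idem_part" for x y
    using that by (simp add: mult) (simp add: f_def Ec idem_part_mid)
  ultimately have "sgp_isomorphic (restrict_to T idem_part)
      (sgp_prod (restrict_to T L) (restrict_to T R))"
    unfolding sgp_isomorphic_def
    using sE sL sR sgp_prod_semigrp[OF sL sR]
    by (intro conjI exI[of _ f]) (auto simp: restrict_to_def sgp_prod_def case_prod_beta)
  moreover have "left_zero_semigrp (restrict_to T L)"
    using sL Lz by (auto simp: left_zero_semigrp_def restrict_to_def)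
  moreover have "right_zero_semigrp (restrict_to T R)"
    using sR Rz by (auto simp: right_zero_semigrp_def restrict_to_def)
  ultimately show ?thesis unfolding rectangular_band_def by blast
qed

theorem group_unit_part: "group_semigrp (restrict_to T unit_part)"
proof -
  have c: "x \<in> carrier T" if "x \<in> unit_part" for x using that by (simp add: unit_part_def)
  have local: "b \<odot> (x \<odot> b) = x" if "x \<in> unit_part" for x using that by (simp add: unit_part_def)
  have mult: "x \<odot> y \<in> unit_part" if x: "x \<in> unit_part" and y: "y \<in> unit_part" for x y
  proof -
    have "b \<odot> (x \<odot> y \<odot> b) = (b \<odot> (x \<odot> b)) \<odot> (b \<odot> (y \<odot> b))" using x y by (simp add: c)
    also have "\<dots> = x \<odot> y" using x y by (simp only: local)
    finally show ?thesis
      using x y inverse_pair_mult unfolding unit_part_def by (simp; blast)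
  qed
  have bU: "b \<in> unit_part" using inverse_pair_b by (auto simp: unit_part_def)
  have left_one: "b \<odot> x = x" and right_one: "x \<odot> b = x" if "x \<in> unit_part" for x
  proof -
    have "b \<odot> (b \<odot> (x \<odot> b)) = b \<odot> (x \<odot> b)" "b \<odot> (x \<odot> b) \<odot> b = b \<odot> (x \<odot> b)"
      using c[OF that] by simp_all
    then show "b \<odot> x = x" "x \<odot> b = x" by (simp_all only: local[OF that])
  qed
  have left_inverse: "\<exists>y \<in> unit_part. y \<odot> x = b" if x: "x \<in> unit_part" for x
  proof -
    obtain h where h: "inverse_pair x h" using x by (auto simp: unit_part_def)
    note hc = inverse_pair_carrier(2)[OF h]
    have "b \<odot> (h \<odot> b) \<in> unit_part"
      using inverse_pair_sym[OF inverse_pair_localise[OF h]] hc by (auto simp: unit_part_def)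
    moreover have "b \<odot> (h \<odot> b) \<odot> x = b \<odot> (h \<odot> (x \<odot> b))"
      using c[OF x] hc right_one[OF x] by simp
    then have "b \<odot> (h \<odot> b) \<odot> x = b" using h by (simp only: inverse_pair_def)
    ultimately show ?thesis by blast
  qed
  have "group \<lparr>carrier = unit_part, monoid.mult = comp T, one = b\<rparr>"
    by (rule groupI) (simp_all add: c mult bU left_one left_inverse)
  moreover have "semigrp (restrict_to T unit_part)"
    by (rule restrict_semigrp) (auto simp: c mult)
  ultimately show ?thesis
    by (auto simp: group_semigrp_def restrict_to_def)
qed

end


section \<open>The block of the mid-identity\<close>

text \<open>Every two-sided divisor of \<open>b\<close> has an invertible image. This is the trace that stability of \<open>S\<close>
  leaves on its sandwich semigroups.\<close>

locale stable_mid_identity = mid_identity +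
  assumes divisor_invertible:
    "\<lbrakk>u \<in> carrier T; x \<in> carrier T; v \<in> carrier T; b = u \<odot> (x \<odot> v)\<rbrakk> \<Longrightarrow> \<exists>h. inverse_pair x h"
begin

lemma factors_invertible:
  assumes "p \<in> carrier T" "q \<in> carrier T" "inverse_pair (p \<odot> q) h"
  obtains k l where "inverse_pair p k" "inverse_pair q l"
proof -
  have h: "h \<in> carrier T" and e: "b \<odot> (p \<odot> (q \<odot> (h \<odot> b))) = b"
    using assms by (auto simp: inverse_pair_def)
  have "\<exists>k. inverse_pair p k"
    by (rule divisor_invertible[of b _ "q \<odot> (h \<odot> b)"]) (use assms h e in simp_all)
  moreover have "\<exists>l. inverse_pair q l"
    by (rule divisor_invertible[of "b \<odot> p" _ "h \<odot> b"]) (use assms h e in simp_all)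
  ultimately show ?thesis using that by blast
qed

text \<open>For \<open>x = p q\<close> with \<open>k\<close> paired with \<open>p\<close>, inserting \<open>k p\<close> between \<open>p\<close> and \<open>q\<close> lets \<open>p q h\<close> cancel.\<close>

lemma block_inner_inverse:
  assumes x: "x \<in> block" and h: "inverse_pair x h"
  shows "x \<odot> (h \<odot> x) = x"
proof -
  obtain p q where pq: "p \<in> carrier T" "q \<in> carrier T" "x = p \<odot> q"
    using x by (auto simp: block_def)
  obtain k where k: "inverse_pair p k" using factors_invertible h pq by metis
  note c = pq(1,2) inverse_pair_carrier(2)[OF h] inverse_pair_carrier(2)[OF k]
  have "x \<odot> (h \<odot> x) = p \<odot> (q \<odot> (h \<odot> (p \<odot> q)))"
    using c pq by simp
  also have "\<dots> = p \<odot> (k \<odot> (p \<odot> (q \<odot> (h \<odot> (p \<odot> q)))))"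
    using c cancel[OF inverse_pair_sym[OF k], of p "q \<odot> (h \<odot> (p \<odot> q))"] by simp
  also have "\<dots> = p \<odot> (k \<odot> (p \<odot> q))"
    using c pq cancel[OF h, of "p \<odot> k" "p \<odot> q"] by simp
  also have "\<dots> = x"
    using c pq cancel[OF inverse_pair_sym[OF k], of p q] by simp
  finally show ?thesis .
qed

lemma block_mult:
  assumes "x \<in> block" "y \<in> block"
  shows "x \<odot> y \<in> block"
  using assms inverse_pair_mult unfolding block_def by (simp; blast)

lemma green_J_b: "green_J T `` {b} = block"
proof (intro Set.set_eqI iffI)
  fix x assume "x \<in> green_J T `` {b}"
  then have bx: "(b, x) \<in> le_J T" and xb: "(x, b) \<in> le_J T" by (auto simp: green_J_def)
  then have x: "x \<in> carrier T" by (auto simp: le_J_def)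
  have "\<exists>p \<in> carrier T. \<exists>q \<in> carrier T. x = p \<odot> q"
    using xb
  proof (cases rule: le_J_cases)
    case 1 then show ?thesis using b_in b_idem by metis
  next
    case (2 u) then show ?thesis using b_in by blast
  next
    case (3 v) then show ?thesis using b_in by blast
  next
    case (4 u v) then show ?thesis using b_in closed by blast
  qed
  moreover have "\<exists>u \<in> carrier T. \<exists>v \<in> carrier T. b = u \<odot> (x \<odot> v)"
    using bx
  proof (cases rule: le_J_cases)
    case 1 then show ?thesis using x by (metis b_in b_idem)
  next
    case (2 u)
    then have "b = u \<odot> (x \<odot> b)" using x b_idem by (metis assoc b_in)
    then show ?thesis using 2 b_in by blast
  next
    case (3 v)
    then have "b = b \<odot> (x \<odot> v)" by (metis b_idem)
    then show ?thesis using 3 b_in by blast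
  next
    case (4 u v)
    then have "b = u \<odot> (x \<odot> v)" using x by simp
    then show ?thesis using 4 by blast
  qed
  ultimately show "x \<in> block" using x divisor_invertible by (auto simp: block_def)
next
  fix x assume "x \<in> block"
  then obtain p q h where c: "p \<in> carrier T" "q \<in> carrier T" "x \<in> carrier T"
    and x: "x = p \<odot> q" and h: "inverse_pair x h" by (auto simp: block_def)
  have "(p \<odot> b \<odot> q, b) \<in> le_J T" by (rule le_J_comp) (use c in simp_all)
  then have "(x, b) \<in> le_J T" using c x by simp
  moreover have "(b \<odot> x \<odot> (h \<odot> b), x) \<in> le_J T"
    by (rule le_J_comp) (use c h in \<open>simp_all add: inverse_pair_def\<close>)
  then have "(b, x) \<in> le_J T" using c h by (simp add: inverse_pair_def)
  ultimately show "x \<in> green_J T `` {b}" by (simp add: green_J_def)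
qed

text \<open>The block is closed under both relations that generate \<open>\<D>\<close>.\<close>

lemma block_green_step:
  assumes x: "x \<in> block" and xy: "(x, y) \<in> green_R T \<union> green_L T"
  shows "y \<in> block"
proof -
  obtain h where "x \<in> carrier T" and h: "inverse_pair x h"
    using x by (auto simp: block_def)
  note hc = inverse_pair_carrier(2)[OF h]
  have e: "b \<odot> (x \<odot> (h \<odot> b)) = b" "b \<odot> (h \<odot> (x \<odot> b)) = b"
    using h by (auto simp: inverse_pair_def)
  have yc: "y \<in> carrier T" using xy by (auto simp: green_R_def green_L_def le_R_def le_L_def)
  have "y = x \<or> (\<exists>u \<in> carrier T. y = x \<odot> u \<or> y = u \<odot> x)"
    using xy by (auto simp: green_R_def green_L_def le_R_iff le_L_iff)
  then have "\<exists>p \<in> carrier T. \<exists>q \<in> carrier T. y = p \<odot> q"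
    using x by (auto simp: block_def)
  moreover have "\<exists>k. inverse_pair y k"
  proof -
    consider "x = y" | v where "v \<in> carrier T" "x = y \<odot> v" | v where "v \<in> carrier T" "x = v \<odot> y"
      using xy by (auto simp: green_R_def green_L_def le_R_iff le_L_iff)
    then show ?thesis
    proof cases
      case 1 then show ?thesis using h by blast
    next
      case 2
      show ?thesis
        by (rule divisor_invertible[of b _ "v \<odot> (h \<odot> b)"]) (use 2 yc hc e in simp_all)
    next
      case 3
      show ?thesis
        by (rule divisor_invertible[of "b \<odot> (h \<odot> v)" _ b]) (use 3 yc hc e in simp_all)
    qed
  qed
  ultimately show ?thesis using yc by (simp add: block_def)
qed

lemma green_D_b: "green_D T `` {b} = block"
proof (intro Set.set_eqI iffI)
  fix x assume "x \<in> green_D T `` {b}"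
  then have "(b, x) \<in> (green_R T \<union> green_L T)\<^sup>+" by (simp add: green_D_def)
  then show "x \<in> block"
  proof induction
    case (base y)
    have "b \<in> block" using inverse_pair_b b_idem unfolding block_def by (metis (mono_tags, lifting) b_in mem_Collect_eq)
    then show ?case using base by (rule block_green_step)
  next
    case (step y z) then show ?case by (blast intro: block_green_step)
  qed
next
  fix x assume "x \<in> block"
  then obtain p q h where c: "p \<in> carrier T" "q \<in> carrier T" "x \<in> carrier T"
    and x: "x = p \<odot> q" and h: "inverse_pair x h" by (auto simp: block_def)
  obtain k l where k: "inverse_pair p k" and l: "inverse_pair q l"
    using factors_invertible[OF c(1,2)] h x by metis
  note kl = inverse_pair_carrier(2)[OF k] inverse_pair_carrier(2)[OF l]
  \<comment> \<open>The intermediate element between \<open>b\<close> and \<open>p q\<close> is \<open>b q\<close>.\<close>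
  have "b \<odot> q \<odot> (l \<odot> b) = b" using l c kl by (simp add: inverse_pair_def)
  then have "(b, b \<odot> q) \<in> le_R T" "(b \<odot> q, b) \<in> le_R T"
    using c kl unfolding le_R_iff_one by (metis b_in closed)+
  moreover have "b \<odot> k \<odot> (p \<odot> q) = b \<odot> q" "p \<odot> (b \<odot> q) = x"
    using c kl x cancel[OF inverse_pair_sym[OF k], of b q] by simp_all
  then have "(b \<odot> q, x) \<in> le_L T" "(x, b \<odot> q) \<in> le_L T"
    using c kl x unfolding le_L_iff_one by (metis b_in closed)+
  ultimately have "(b, b \<odot> q) \<in> green_R T" "(b \<odot> q, x) \<in> green_L T"
    by (simp_all add: green_R_def green_L_def)
  then show "x \<in> green_D T `` {b}"
    unfolding green_D_def by (auto intro: trancl_into_trancl)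
qed

text \<open>In the block every element \<open>x\<close> lies in a subgroup. If \<open>h\<close> is paired with \<open>x\<close>, the identity of that subgroup is \<open>x h h x\<close>; together with \<open>b x b\<close> it determines \<open>x\<close>.\<close>

theorem rectangular_group_block: "rectangular_group (restrict_to T block)"
proof -
  define inverse_of where "inverse_of x = (SOME h. inverse_pair x h)" for x
  define e where "e x = x \<odot> (inverse_of x \<odot> (inverse_of x \<odot> x))" for x
  define f where "f x = (e x, b \<odot> (x \<odot> b))" for x
  have c: "x \<in> carrier T" if "x \<in> block" for x using that by (simp add: block_def)
  have ip: "inverse_pair x (inverse_of x)" if "\<exists>h. inverse_pair x h" for x
    unfolding inverse_of_def using that by (rule someI_ex)
  have bip: "inverse_pair x (inverse_of x)" if "x \<in> block" for x
    using that ip by (simp add: block_def)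
  have ic: "inverse_of x \<in> carrier T" if "x \<in> block" for x
    using inverse_pair_carrier(2)[OF bip[OF that]] .
  note cl = cancel[OF bip] and cr = cancel[OF inverse_pair_sym[OF bip]]
  have Ec: "x \<in> carrier T" if "x \<in> idem_part" for x using that by (simp add: idem_part_def)
  have Gc: "g \<in> carrier T" "b \<odot> (g \<odot> b) = g" if "g \<in> unit_part" for g
    using that by (simp_all add: unit_part_def)
  have e_in: "e x \<in> idem_part" if x: "x \<in> block" for x
  proof -
    note cs = c[OF x] ic[OF x]
    have "e x \<odot> e x = e x"
      using cs x by (simp add: e_def cl cr)
    moreover have "b \<odot> (e x \<odot> b) = b"
      using cs x by (simp add: e_def cl cr)
    ultimately show ?thesis using cs by (simp add: idem_part_def e_def)
  qed
  have e_any: "e x = x \<odot> (h \<odot> (h \<odot> x))" if x: "x \<in> block" and h: "inverse_pair x h" for x h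
  proof -
    note cs = c[OF x] ic[OF x] inverse_pair_carrier(2)[OF h]
    \<comment> \<open>Any two elements paired with \<open>x\<close> agree between two further factors.\<close>
    have agree: "y \<odot> (inverse_of x \<odot> z) = y \<odot> (h \<odot> z)" if "y \<in> carrier T" "z \<in> carrier T" for y z
    proof -
      have "y \<odot> (inverse_of x \<odot> z) = y \<odot> (inverse_of x \<odot> (x \<odot> (h \<odot> z)))"
        using cancel[OF h, of "y \<odot> inverse_of x" z] cs that by simp
      also have "\<dots> = y \<odot> (h \<odot> z)" using cr[OF x, of y "h \<odot> z"] cs that by simp
      finally show ?thesis .
    qed
    show ?thesis
      using agree[of x "inverse_of x \<odot> x"] agree[of "x \<odot> h" x] cs by (simp add: e_def)
  qed
  have img: "b \<odot> (x \<odot> b) \<in> unit_part" if x: "x \<in> block" for x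
    using inverse_pair_localise[OF bip[OF x]] c[OF x] by (auto simp: unit_part_def)
  have hom: "f (x \<odot> y) = (e x \<odot> e y, b \<odot> (x \<odot> b) \<odot> (b \<odot> (y \<odot> b)))"
    if x: "x \<in> block" and y: "y \<in> block" for x y
  proof -
    note cs = c[OF x] ic[OF x] c[OF y] ic[OF y]
    have "e (x \<odot> y) = x \<odot> y \<odot> (inverse_of y \<odot> inverse_of x \<odot> (inverse_of y \<odot> inverse_of x \<odot> (x \<odot> y)))"
      by (rule e_any[OF block_mult[OF x y] inverse_pair_mult[OF bip[OF x] bip[OF y]]])
    also have "\<dots> = x \<odot> (inverse_of x \<odot> (inverse_of y \<odot> (inverse_of x \<odot> (x \<odot> y))))"
      using cs cl[OF y, of x "inverse_of x \<odot> (inverse_of y \<odot> (inverse_of x \<odot> (x \<odot> y)))"] by simp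
    also have "\<dots> = x \<odot> (inverse_of x \<odot> (inverse_of y \<odot> y))"
      using cs cr[OF x, of "x \<odot> (inverse_of x \<odot> inverse_of y)" y] by simp
    also have "\<dots> = e x \<odot> e y" using cs x y by (simp add: e_def cl cr)
    finally show ?thesis using cs by (simp add: f_def)
  qed
  have recover: "x \<odot> (g \<odot> x) \<in> block" "f (x \<odot> (g \<odot> x)) = (x, g)"
    if x: "x \<in> idem_part" and g: "g \<in> unit_part" for x g
  proof -
    obtain h where h: "inverse_pair g h" using g by (auto simp: unit_part_def)
    note cs = Ec[OF x] Gc(1)[OF g] inverse_pair_carrier(2)[OF h]
    note m = idem_part_mid[OF x]
    have p: "inverse_pair (x \<odot> (g \<odot> x)) h"
      using h cs by (simp add: inverse_pair_def m)
    then show blk: "x \<odot> (g \<odot> x) \<in> block" using cs by (auto simp: block_def)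
    have "e (x \<odot> (g \<odot> x)) = x \<odot> (g \<odot> (h \<odot> (h \<odot> (g \<odot> x))))"
      using e_any[OF blk p] cs by (simp add: m)
    also have "\<dots> = x \<odot> (h \<odot> (g \<odot> x))" using cancel[OF h, of x "h \<odot> (g \<odot> x)"] cs by simp
    also have "\<dots> = x" using cancel[OF inverse_pair_sym[OF h], of x x] cs x
      by (simp add: idem_part_def)
    finally show "f (x \<odot> (g \<odot> x)) = (x, g)" using cs Gc(2)[OF g] by (simp add: f_def m)
  qed
  have bij: "bij_betw f block (idem_part \<times> unit_part)"
  proof (rule bij_betwI[where g = "\<lambda>(x, g). x \<odot> (g \<odot> x)"])
    show "f \<in> block \<rightarrow> idem_part \<times> unit_part" by (auto simp: f_def e_in img)
    show "(\<lambda>(x, g). x \<odot> (g \<odot> x)) \<in> idem_part \<times> unit_part \<rightarrow> block" by (auto intro: recover)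
    show "(\<lambda>(x, g). x \<odot> (g \<odot> x)) (f x) = x" if x: "x \<in> block" for x
    proof -
      note cs = c[OF x] ic[OF x]
      have "e x \<odot> (b \<odot> (x \<odot> b) \<odot> e x) = x \<odot> (inverse_of x \<odot> x)"
        using cs x by (simp add: e_def cl cr)
      then show ?thesis using block_inner_inverse[OF x bip[OF x]] by (simp add: f_def)
    qed
    show "f ((\<lambda>(x, g). x \<odot> (g \<odot> x)) y) = y" if "y \<in> idem_part \<times> unit_part" for y
      using that by (auto simp: recover)
  qed
  have sJ: "semigrp (restrict_to T block)"
    by (rule restrict_semigrp) (auto simp: c block_mult)
  have sE: "semigrp (restrict_to T idem_part)"
    by (rule restrict_semigrp) (auto simp: Ec idem_part_mult)
  have sG: "semigrp (restrict_to T unit_part)"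
    using group_unit_part by (simp add: group_semigrp_def)
  have "sgp_isomorphic (restrict_to T block)
      (sgp_prod (restrict_to T idem_part) (restrict_to T unit_part))"
    unfolding sgp_isomorphic_def
    using sJ sgp_prod_semigrp[OF sE sG] bij hom
    by (intro conjI exI[of _ f]) (auto simp: restrict_to_def sgp_prod_def f_def)
  then show ?thesis
    unfolding rectangular_group_def using rectangular_band_idem_part group_unit_part by blast
qed

lemma block_eq_regular: "block = {x \<in> Reg T. \<exists>h. inverse_pair x h}"
proof (intro Set.set_eqI iffI)
  fix x assume x: "x \<in> block"
  then obtain h where "x \<in> carrier T" "inverse_pair x h" by (auto simp: block_def)
  then show "x \<in> {x \<in> Reg T. \<exists>h. inverse_pair x h}"
    using block_inner_inverse[OF x] inverse_pair_carrier
    by (auto simp: Reg_def regular_elem_iff intro!: bexI[of _ h])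
next
  fix x assume "x \<in> {x \<in> Reg T. \<exists>h. inverse_pair x h}"
  then show "x \<in> block" unfolding block_def Reg_def regular_elem_iff by blast
qed

text \<open>The inner inverse \<open>y\<close> of a regular \<open>x\<close> can be taken regular: replace it by \<open>y x y\<close>.\<close>

lemma regular_inverse:
  assumes "x \<in> Reg T"
  obtains y where "y \<in> Reg T" "x \<odot> (y \<odot> x) = x"
proof -
  obtain y where x: "x \<in> carrier T" and y: "y \<in> carrier T" and e: "x \<odot> (y \<odot> x) = x"
    using assms by (auto simp: Reg_def regular_elem_iff)
  have e': "x \<odot> (y \<odot> (x \<odot> z)) = x \<odot> z" if "z \<in> carrier T" for z
    using arg_cong[OF e, of "\<lambda>w. w \<odot> z"] x y that by simp
  have "y \<odot> (x \<odot> y) \<in> Reg T"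
    using x y by (auto simp: Reg_def regular_elem_iff e' intro!: bexI[of _ x])
  moreover have "x \<odot> (y \<odot> (x \<odot> y) \<odot> x) = x" using x y by (simp add: e' e)
  ultimately show ?thesis by (rule that)
qed

lemma b_Reg: "b \<in> Reg T"
  unfolding Reg_def regular_elem_iff by (auto intro!: bexI[of _ b])

lemma MI_Reg: "MI (restrict_to T (Reg T)) = idem_part"
proof (intro Set.set_eqI iffI)
  have Rc: "x \<in> carrier T" if "x \<in> Reg T" for x using that by (simp add: Reg_def regular_elem_iff)
  have MI_iff: "u \<in> MI (restrict_to T (Reg T)) \<longleftrightarrow>
      u \<in> Reg T \<and> (\<forall>x \<in> Reg T. \<forall>y \<in> Reg T. x \<odot> y = x \<odot> u \<odot> y)" for u
    by (simp add: MI_def restrict_to_def)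
  {
    fix u assume u: "u \<in> idem_part"
    then have "u \<in> carrier T" "u = u \<odot> (u \<odot> u)" by (auto simp: idem_part_def)
    then have "u \<in> Reg T" by (auto simp: Reg_def regular_elem_iff)
    then show "u \<in> MI (restrict_to T (Reg T))"
      using u Rc by (simp add: MI_iff idem_part_mid \<open>u \<in> carrier T\<close>)
  next
    fix u assume "u \<in> MI (restrict_to T (Reg T))"
    then have u: "u \<in> Reg T"
      and m: "\<And>x y. x \<in> Reg T \<Longrightarrow> y \<in> Reg T \<Longrightarrow> x \<odot> u \<odot> y = x \<odot> y"
      unfolding MI_iff by metis+
    obtain y where y: "y \<in> Reg T" "u \<odot> (y \<odot> u) = u" using regular_inverse[OF u] .
    have "b \<odot> (u \<odot> b) = b" using m[OF b_Reg b_Reg] u Rc by simp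
    moreover have "u \<odot> u = u"
    proof -
      have "u \<odot> u = (u \<odot> u \<odot> y) \<odot> u" using y u Rc by simp
      also have "\<dots> = u" unfolding m[OF u y(1)] using y u Rc by simp
      finally show ?thesis .
    qed
    ultimately show "u \<in> idem_part" using u Rc by (simp add: idem_part_def)
  }
qed

lemma RP_Reg:
  assumes Reg_mult: "\<And>x y. x \<in> Reg T \<Longrightarrow> y \<in> Reg T \<Longrightarrow> x \<odot> y \<in> Reg T"
  shows "RP (restrict_to T (Reg T)) = block"
proof -
  have Rc: "x \<in> carrier T" if "x \<in> Reg T" for x using that by (simp add: Reg_def regular_elem_iff)
  have RP_iff: "u \<in> RP (restrict_to T (Reg T)) \<longleftrightarrow>
      u \<in> Reg T \<and> (\<forall>x \<in> Reg T. \<exists>z \<in> Reg T. x = x \<odot> (u \<odot> (z \<odot> (u \<odot> x))))" for u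
    by (simp add: RP_def restrict_to_def sandwich_def hom_set_def regular_psgp_def
        regular_elem_def Rc cong: ball_cong bex_cong conj_cong)
  show ?thesis
  proof (intro Set.set_eqI iffI)
    fix u assume "u \<in> RP (restrict_to T (Reg T))"
    then obtain z where u: "u \<in> Reg T" and z: "z \<in> Reg T"
      and e: "b = b \<odot> (u \<odot> (z \<odot> (u \<odot> b)))" unfolding RP_iff using b_Reg by blast
    have "\<exists>h. inverse_pair u h"
      by (rule divisor_invertible[of b _ "z \<odot> (u \<odot> b)"]) (use u z Rc e in simp_all)
    then show "u \<in> block" using u by (simp add: block_eq_regular)
  next
    fix u assume "u \<in> block"
    then obtain h where u: "u \<in> Reg T" and h: "inverse_pair u h" by (auto simp: block_eq_regular)
    note hc = inverse_pair_carrier(2)[OF h]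
    \<comment> \<open>\<open>b h b\<close> replaces \<open>h\<close>, which need not be regular itself.\<close>
    define g where "g = b \<odot> (h \<odot> b)"
    have gc: "g \<in> carrier T" using hc by (simp add: g_def)
    have "g = g \<odot> (u \<odot> g)"
      using hc u Rc cancel[OF inverse_pair_sym[OF h], of b "h \<odot> b"] by (simp add: g_def)
    then have g: "g \<in> Reg T" using Rc[OF u] gc unfolding Reg_def regular_elem_iff by blast
    have "\<exists>z \<in> Reg T. x = x \<odot> (u \<odot> (z \<odot> (u \<odot> x)))" if x: "x \<in> Reg T" for x
    proof -
      obtain y where y: "y \<in> Reg T" "x \<odot> (y \<odot> x) = x" using regular_inverse[OF x] .
      note cs = Rc[OF x] Rc[OF u] Rc[OF y(1)] hc
      have "x \<odot> (u \<odot> (g \<odot> y \<odot> g \<odot> (u \<odot> x))) = x \<odot> (u \<odot> (h \<odot> (y \<odot> (h \<odot> (u \<odot> x)))))"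
        using cs by (simp add: g_def)
      also have "\<dots> = x \<odot> (y \<odot> (h \<odot> (u \<odot> x)))"
        using cancel[OF h, of x "y \<odot> (h \<odot> (u \<odot> x))"] cs by simp
      also have "\<dots> = x"
        using cancel[OF inverse_pair_sym[OF h], of "x \<odot> y" x] cs y by simp
      finally show ?thesis using Reg_mult g y by metis
    qed
    then show "u \<in> RP (restrict_to T (Reg T))" using u by (simp add: RP_iff)
  qed
qed

end


section \<open>Sandwich semigroups\<close>

lemma sandwich_simps [simp]:
  "carrier (sandwich S i j a) = hom_set S i j"
  "comp (sandwich S i j a) x y = x \<odot>\<^bsub>S\<^esub> a \<odot>\<^bsub>S\<^esub> y"
  "objs (sandwich S i j a) = {()}"
  by (simp_all add: sandwich_def)

context partial_semigroup
begin

lemmas comp_simps = comp_closed src_comp tgt_comp comp_assoc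

lemma sandwich_one_object:
  assumes "a \<in> hom_set S j i"
  shows "one_object (sandwich S i j a)"
  using assms by unfold_locales (auto simp: hom_set_def comp_simps)

lemma sandwich_mid_identity:
  assumes a: "a \<in> hom_set S j i" and b: "b \<in> inverses S a"
  shows "mid_identity (sandwich S i j a) b"
proof -
  interpret T: one_object "sandwich S i j a" by (rule sandwich_one_object[OF a])
  have a': "a \<in> carrier S" "src S a = j" "tgt S a = i" using a by (auto simp: hom_set_def)
  have b': "b \<in> carrier S" "src S b = i" "tgt S b = j"
    and e: "a \<odot> b \<odot> a = a" "b \<odot> a \<odot> b = b" using a' b by (auto simp: inverses_def)
  have mid: "x \<odot> a \<odot> b \<odot> a \<odot> y = x \<odot> a \<odot> y" if "x \<in> hom_set S i j" "y \<in> hom_set S i j" for x y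
  proof -
    have "x \<odot> a \<odot> b \<odot> a \<odot> y = x \<odot> (a \<odot> b \<odot> a) \<odot> y"
      using that a' b' by (simp add: hom_set_def comp_simps)
    then show ?thesis by (simp only: e)
  qed
  show ?thesis
    by unfold_locales (use b' e mid in \<open>auto simp: hom_set_def\<close>)
qed

text \<open>This is the only use of stability. If \<open>b = u x v\<close> in the sandwich semigroup, then
  \<open>a\<close> and \<open>a x a\<close> are \<open>\<J>\<close>-related in \<open>S\<close>, so \<open>a \<in> a x a S\<^sup>1\<close> and \<open>a \<in> S\<^sup>1 a x a\<close>. The
  resulting factors, multiplied by \<open>b\<close> to bring them into \<open>S\<^sub>i\<^sub>j\<close>, invert \<open>x\<close>.\<close>

lemma sandwich_stable_mid_identity:
  assumes a: "a \<in> hom_set S j i" and b: "b \<in> inverses S a" and stable: "stable S"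
  shows "stable_mid_identity (sandwich S i j a) b"
proof -
  let ?T = "sandwich S i j a"
  interpret T: mid_identity ?T b by (rule sandwich_mid_identity[OF a b])
  have a': "a \<in> carrier S" "src S a = j" "tgt S a = i" using a by (auto simp: hom_set_def)
  have b': "b \<in> carrier S" "src S b = i" "tgt S b = j"
    and e: "a \<odot> b \<odot> a = a" "b \<odot> a \<odot> b = b" using a' b by (auto simp: inverses_def)
  have ea: "a \<odot> (b \<odot> a) = a" using e a' b' by (simp add: comp_simps)
  have "\<exists>h. T.inverse_pair x h"
    if hs: "u \<in> carrier ?T" "x \<in> carrier ?T" "v \<in> carrier ?T" and "b = u \<odot>\<^bsub>?T\<^esub> (x \<odot>\<^bsub>?T\<^esub> v)" for u x v
  proof -
    have u: "u \<in> carrier S" "src S u = i" "tgt S u = j"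
      and x: "x \<in> carrier S" "src S x = i" "tgt S x = j"
      and v: "v \<in> carrier S" "src S v = i" "tgt S v = j"
      using hs by (auto simp: hom_set_def)
    note cs = a' b' u x v
    have buxv: "b = u \<odot> (a \<odot> (x \<odot> (a \<odot> v)))" using that(4) cs by (simp add: comp_simps)
    have "a = a \<odot> (u \<odot> (a \<odot> (x \<odot> (a \<odot> v)))) \<odot> a" using e buxv by simp
    then have "a = (a \<odot> u) \<odot> (a \<odot> (x \<odot> a)) \<odot> (v \<odot> a)" using cs by (simp add: comp_simps)
    moreover have "((a \<odot> u) \<odot> (a \<odot> (x \<odot> a)) \<odot> (v \<odot> a), a \<odot> (x \<odot> a)) \<in> le_J S"
      by (rule le_J_comp) (use cs in \<open>simp_all add: comp_simps\<close>)
    ultimately have down: "(a, a \<odot> (x \<odot> a)) \<in> le_J S" by simp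
    have axa: "x \<odot> a \<in> carrier S" "src S (x \<odot> a) = i" "a \<odot> x \<in> carrier S" "tgt S (a \<odot> x) = j"
      "src S (a \<odot> (x \<odot> a)) = j" "tgt S (a \<odot> (x \<odot> a)) = i" "a \<odot> x \<odot> a = a \<odot> (x \<odot> a)"
      using cs by (simp_all add: comp_simps)
    have up: "(a \<odot> (x \<odot> a), a) \<in> le_J S"
      by (rule le_R_imp_le_J, unfold le_R_iff) (use a' axa comp_closed in metis)
    have J: "(a, a \<odot> (x \<odot> a)) \<in> green_J S" using down up by (simp add: green_J_def)
    have "(a, a \<odot> (x \<odot> a)) \<in> green_R S"
      using stable J a' axa unfolding stable_def by metis
    then have "(a, a \<odot> (x \<odot> a)) \<in> le_R S" by (simp add: green_R_def)
    then have "a = a \<odot> (x \<odot> a) \<or> (\<exists>t \<in> carrier S. src S t = i \<and> a = a \<odot> (x \<odot> a) \<odot> t)"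
      unfolding le_R_iff using axa by metis
    then obtain c where c: "c \<in> carrier S" "src S c = i" "tgt S c = j"
      and ac: "a \<odot> (x \<odot> (a \<odot> (c \<odot> a))) = a"
    proof
      assume "a = a \<odot> (x \<odot> a)"
      then have "a \<odot> (x \<odot> a) = a" ..
      then have "a \<odot> (x \<odot> (a \<odot> (b \<odot> a))) = a" using ea by simp
      then show ?thesis using that[of b] b' by blast
    next
      assume "\<exists>t \<in> carrier S. src S t = i \<and> a = a \<odot> (x \<odot> a) \<odot> t"
      then obtain t where t: "t \<in> carrier S" "src S t = i" "a \<odot> (x \<odot> a) \<odot> t = a" by metis
      have "tgt S (a \<odot> (x \<odot> a) \<odot> t) = tgt S t" using t(1,2) cs by (simp add: comp_simps)
      then have tt: "tgt S t = i" using t(3) a' by simp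
      have "a \<odot> (x \<odot> (a \<odot> (t \<odot> b \<odot> a))) = a \<odot> (x \<odot> a) \<odot> t \<odot> (b \<odot> a)"
        using t(1,2) tt cs by (simp add: comp_simps)
      also have "\<dots> = a" using t(3) ea by simp
      finally show ?thesis using that[of "t \<odot> b"] t(1,2) tt b' by (simp add: comp_closed src_comp tgt_comp)
    qed
    have "(a, a \<odot> (x \<odot> a)) \<in> green_L S"
      using stable J a' axa unfolding stable_def by metis
    then have "(a, a \<odot> (x \<odot> a)) \<in> le_L S" by (simp add: green_L_def)
    then have "a = a \<odot> (x \<odot> a) \<or> (\<exists>t \<in> carrier S. tgt S t = j \<and> a = t \<odot> (a \<odot> (x \<odot> a)))"
      unfolding le_L_iff using axa by metis
    then obtain d where d: "d \<in> carrier S" "src S d = i" "tgt S d = j"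
      and ad: "a \<odot> (d \<odot> (a \<odot> (x \<odot> a))) = a"
    proof
      assume "a = a \<odot> (x \<odot> a)"
      then have "a \<odot> (x \<odot> a) = a" ..
      then have "a \<odot> (b \<odot> (a \<odot> (x \<odot> a))) = a" using ea by simp
      then show ?thesis using that[of b] b' by blast
    next
      assume "\<exists>t \<in> carrier S. tgt S t = j \<and> a = t \<odot> (a \<odot> (x \<odot> a))"
      then obtain t where t: "t \<in> carrier S" "tgt S t = j" "t \<odot> (a \<odot> (x \<odot> a)) = a" by metis
      have "src S (t \<odot> (a \<odot> (x \<odot> a))) = src S t" using t(1,2) cs by (simp add: comp_simps)
      then have ts: "src S t = j" using t(3) a' by simp
      have "a \<odot> (b \<odot> t \<odot> (a \<odot> (x \<odot> a))) = a \<odot> (b \<odot> (t \<odot> (a \<odot> (x \<odot> a))))"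
        using t(1,2) ts cs by (simp add: comp_simps)
      also have "\<dots> = a" using t(3) ea by simp
      finally show ?thesis using that[of "b \<odot> t"] t(1,2) ts b' by (simp add: comp_closed src_comp tgt_comp)
    qed
    \<comment> \<open>The one-sided inverses \<open>c\<close> and \<open>d\<close> combine to a two-sided one.\<close>
    define h where "h = d \<odot> (a \<odot> (x \<odot> (a \<odot> c)))"
    have h: "h \<in> carrier S" "src S h = i" "tgt S h = j"
      using c d cs by (simp_all add: h_def comp_simps)
    have "a \<odot> (x \<odot> (a \<odot> (h \<odot> a))) = a \<odot> x \<odot> (a \<odot> (d \<odot> (a \<odot> (x \<odot> a)))) \<odot> (c \<odot> a)"
      using c d cs by (simp add: h_def comp_simps)
    also have "\<dots> = a \<odot> (x \<odot> (a \<odot> (c \<odot> a)))" unfolding ad using c cs by (simp add: comp_simps)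
    finally have r: "a \<odot> (x \<odot> (a \<odot> (h \<odot> a))) = a" using ac by simp
    have "a \<odot> (h \<odot> (a \<odot> (x \<odot> a))) = a \<odot> d \<odot> (a \<odot> (x \<odot> (a \<odot> (c \<odot> a)))) \<odot> (x \<odot> a)"
      using c d cs by (simp add: h_def comp_simps)
    also have "\<dots> = a \<odot> (d \<odot> (a \<odot> (x \<odot> a)))" unfolding ac using d cs by (simp add: comp_simps)
    finally have l: "a \<odot> (h \<odot> (a \<odot> (x \<odot> a))) = a" using ad by simp
    have "b \<odot>\<^bsub>?T\<^esub> (x \<odot>\<^bsub>?T\<^esub> (h \<odot>\<^bsub>?T\<^esub> b)) = b \<odot> (a \<odot> (x \<odot> (a \<odot> (h \<odot> a)))) \<odot> b"
      using cs h by (simp add: comp_simps)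
    moreover have "b \<odot>\<^bsub>?T\<^esub> (h \<odot>\<^bsub>?T\<^esub> (x \<odot>\<^bsub>?T\<^esub> b)) = b \<odot> (a \<odot> (h \<odot> (a \<odot> (x \<odot> a)))) \<odot> b"
      using cs h by (simp add: comp_simps)
    ultimately have "T.inverse_pair x h"
      unfolding T.inverse_pair_def using r l e hs h by (simp add: hom_set_def)
    then show ?thesis ..
  qed
  then show ?thesis by unfold_locales
qed

lemma inverses_sandwich:
  assumes a: "a \<in> hom_set S j i" and b: "b \<in> inverses S a"
  shows "mid_identity.idem_part (sandwich S i j a) b = inverses S a"
proof -
  let ?T = "sandwich S i j a"
  interpret T: mid_identity ?T b by (rule sandwich_mid_identity[OF a b])
  have a': "a \<in> carrier S" "src S a = j" "tgt S a = i" using a by (auto simp: hom_set_def)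
  have b': "b \<in> carrier S" "src S b = i" "tgt S b = j"
    and e: "a \<odot> b \<odot> a = a" "b \<odot> a \<odot> b = b" using a' b by (auto simp: inverses_def)
  have "b \<odot>\<^bsub>?T\<^esub> (x \<odot>\<^bsub>?T\<^esub> b) = b \<longleftrightarrow> a \<odot> x \<odot> a = a"
    if x: "x \<in> carrier S" "src S x = i" "tgt S x = j" for x
  proof
    note cs = a' b' x
    assume "b \<odot>\<^bsub>?T\<^esub> (x \<odot>\<^bsub>?T\<^esub> b) = b"
    then have "a \<odot> (b \<odot> a \<odot> x \<odot> a \<odot> b) \<odot> a = a \<odot> b \<odot> a" using cs by (simp add: comp_simps)
    moreover have "a \<odot> (b \<odot> a \<odot> x \<odot> a \<odot> b) \<odot> a = (a \<odot> b \<odot> a) \<odot> x \<odot> (a \<odot> b \<odot> a)"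
      using cs by (simp add: comp_simps)
    ultimately show "a \<odot> x \<odot> a = a" by (simp only: e)
  next
    note cs = a' b' x
    assume "a \<odot> x \<odot> a = a"
    moreover have "b \<odot>\<^bsub>?T\<^esub> (x \<odot>\<^bsub>?T\<^esub> b) = b \<odot> (a \<odot> x \<odot> a) \<odot> b" using cs by (simp add: comp_simps)
    ultimately show "b \<odot>\<^bsub>?T\<^esub> (x \<odot>\<^bsub>?T\<^esub> b) = b" using e by simp
  qed
  then show ?thesis
    using a' unfolding T.idem_part_def inverses_def by (auto simp: hom_set_def)
qed

lemma sandwich_Reg_mult:
  assumes a: "a \<in> hom_set S j i" and reg: "regular_psgp S"
    and x: "x \<in> Reg (sandwich S i j a)" and y: "y \<in> Reg (sandwich S i j a)"
  shows "x \<odot> a \<odot> y \<in> Reg (sandwich S i j a)"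
proof -
  let ?T = "sandwich S i j a"
  interpret T: one_object ?T by (rule sandwich_one_object[OF a])
  have a': "a \<in> carrier S" "src S a = j" "tgt S a = i" using a by (auto simp: hom_set_def)
  obtain x' where xs: "x \<in> carrier S" "src S x = i" "tgt S x = j"
      "x' \<in> carrier S" "src S x' = i" "tgt S x' = j"
    and xe: "x \<odot> a \<odot> (x' \<odot> a \<odot> x) = x"
    using x by (auto simp: Reg_def T.regular_elem_iff hom_set_def)
  obtain y' where ys: "y \<in> carrier S" "src S y = i" "tgt S y = j"
      "y' \<in> carrier S" "src S y' = i" "tgt S y' = j"
    and ye: "y \<odot> a \<odot> (y' \<odot> a \<odot> y) = y"
    using y by (auto simp: Reg_def T.regular_elem_iff hom_set_def)
  note cs = a' xs ys
  have z: "x \<odot> a \<odot> y \<in> carrier S" "src S (x \<odot> a \<odot> y) = i" "tgt S (x \<odot> a \<odot> y) = j"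
    using cs by (simp_all add: comp_simps)
  then obtain w where w: "w \<in> carrier S" "src S w = j" "tgt S w = i"
    and we: "x \<odot> a \<odot> y \<odot> w \<odot> (x \<odot> a \<odot> y) = x \<odot> a \<odot> y"
    using reg unfolding regular_psgp_def regular_elem_def by metis
  \<comment> \<open>An inner inverse of \<open>x a y\<close> in \<open>S\<close> runs from \<open>j\<close> to \<open>i\<close>; extending it by \<open>y'\<close> and \<open>x'\<close> gives one
    from \<open>i\<close> to \<open>j\<close>.\<close>
  define c where "c = y' \<odot> a \<odot> y \<odot> w \<odot> x \<odot> a \<odot> x'"
  have c: "c \<in> hom_set S i j" using cs w by (simp add: c_def hom_set_def comp_simps)
  have "x \<odot> a \<odot> y \<odot> a \<odot> (c \<odot> a \<odot> (x \<odot> a \<odot> y))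
      = x \<odot> a \<odot> (y \<odot> a \<odot> (y' \<odot> a \<odot> y)) \<odot> w \<odot> (x \<odot> a \<odot> (x' \<odot> a \<odot> x) \<odot> a \<odot> y)"
    using cs w by (simp add: c_def comp_simps)
  also have "\<dots> = x \<odot> a \<odot> y" by (simp only: xe ye we)
  finally show ?thesis
    using z c by (auto simp: Reg_def T.regular_elem_iff hom_set_def intro!: bexI[of _ c])
qed

end

theorem proposition3p17:
  fixes S :: "('s, 'i) psgp" and i j :: 'i and a b :: 's
  defines "T \<equiv> sandwich S i j a"
  assumes "partial_semigroup S"
    and "stable S"
    and "i \<in> objs S" and "j \<in> objs S"
    and "a \<in> hom_set S j i"
    and "regular_elem S a"
    and "b \<in> inverses S a"
  shows "green_J T `` {b} = green_D T `` {b} \<and>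
    idempotents T (green_J T `` {b}) = inverses S a \<and>
    rectangular_band (restrict_to T (inverses S a)) \<and>
    rectangular_group (restrict_to T (green_J T `` {b})) \<and>
    (regular_psgp S \<longrightarrow>
      green_J T `` {b} = RP (restrict_to T (Reg T)) \<and>
      idempotents T (green_J T `` {b}) = MI (restrict_to T (Reg T)))"
proof -
  interpret partial_semigroup S by fact
  interpret T: stable_mid_identity T b
    unfolding T_def by (rule sandwich_stable_mid_identity) fact+
  have inverses: "T.idem_part = inverses S a"
    unfolding T_def by (rule inverses_sandwich) fact+
  have "RP (restrict_to T (Reg T)) = T.block" if "regular_psgp S"
    using sandwich_Reg_mult[OF \<open>a \<in> hom_set S j i\<close> that]
    by (intro T.RP_Reg) (simp add: T_def)
  then show ?thesis
    using T.rectangular_band_idem_part T.rectangular_group_block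
    by (simp add: T.green_J_b T.green_D_b T.idempotents_block T.MI_Reg inverses)
qed

end
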